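(* Let $(M,\phi,\xi,\eta,g)$ be a Kenmotsu manifold with a generalized symmetric metric connection $\bar\nabla$ of type $(\alpha,\beta)$, with curvature tensor $\bar R$ and Ricci tensor $\bar S$. If $(g,\xi,\lambda,\mu)$ is an $\eta$-Ricci soliton on $M$ (with respect to $\bar\nabla$) and $\bar S\cdot\bar R(\xi,X)=0$, then $$(\alpha+1)(2\lambda+\mu+\alpha+1)=0.$$
   Context: An almost contact metric manifold is a smooth manifold $M$ of odd dimension with a $(1,1)$-tensor field $\phi$, a vector field $\xi$, a 1-form $\eta$ and a Riemannian metric $g$ such that $\phi\xi=0$, $\eta(\phi X)=0$, $\eta(\xi)=1$, $\phi^2X=-X+\eta(X)\xi$, $g(\phi X,\phi Y)=g(X,Y)-\eta(X)\eta(Y)$, $g(X,\xi)=\eta(X)$. It is a Kenmotsu manifold if, with $\nabla$ the Levi-Civita connection, $(\nabla_X\phi)Y=g(\phi X,Y)\xi-\eta(Y)\phi X$ and $\nabla_X\xi=X-\eta(X)\xi$. For smooth functions $\alpha,\beta$ on $M$, the generalized symmetric metric connection of type $(\alpha,\beta)$ is the linear connection $\bar\nabla$ with $\bar\nabla g=0$ and torsion $T(X,Y)=\alpha\{\eta(Y)X-\eta(X)Y\}+\beta\{\eta(Y)\phi X-\eta(X)\phi Y\}$; explicitly $\bar\nabla_XY=\nabla_XY+\alpha\{\eta(Y)X-g(X,Y)\xi\}-\beta\eta(X)\phi Y$. Its curvature tensor is $\bar R(X,Y)Z=\bar\nabla_X\bar\nabla_YZ-\bar\nabla_Y\bar\nabla_XZ-\bar\nabla_{[X,Y]}Z$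 and its Ricci tensor is $\bar S(Y,Z)=\operatorname{trace}(X\mapsto\bar R(X,Y)Z)$. For real constants $\lambda,\mu$, the data $(g,\xi,\lambda,\mu)$ is an $\eta$-Ricci soliton on $M$ if $\mathcal L_\xi g+2\bar S+2\lambda g+2\mu\,\eta\otimes\eta=0$, where $\mathcal L_\xi g$ is written in terms of $\bar\nabla$, i.e. $2\bar S(X,Y)=-g(\bar\nabla_X\xi,Y)-g(X,\bar\nabla_Y\xi)-2\lambda g(X,Y)-2\mu\eta(X)\eta(Y)$ for all vector fields $X,Y$. The condition $\bar S\cdot\bar R(\xi,X)=0$ means that for all vector fields $X,Y,Z,W$ on $M$ $$\bar S(X,\bar R(Y,Z)W)\xi-\bar S(\xi,\bar R(Y,Z)W)X+\bar S(X,Y)\bar R(\xi,Z)W-\bar S(\xi,Y)\bar R(X,Z)W$$ $$+\bar S(X,Z)\bar R(Y,\xi)W-\bar S(\xi,Z)\bar R(Y,X)W+\bar S(X,W)\bar R(Y,Z)\xi-\bar S(\xi,W)\bar R(Y,Z)X=0.$$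
   Formalization: The manifold is assumed to have dimension at least 3; in dimension 1 the claim fails (M = R, g = dt², ξ = d/dt, φ = 0, α = β = 0, λ = μ = 0 satisfies all hypotheses, but the product equals 1). *)

theory Defs
  imports "HOL-Analysis.Analysis" "HOL-Library.Function_Algebras"
begin

text \<open>
  Tangent vectors are functionals on real functions and vector fields are maps from points to
  such functionals, so both get their pointwise vector space structure from the following instance.
\<close>

instantiation "fun" :: (type, scaleR) scaleR
begin

definition scaleR_fun :: "real \<Rightarrow> ('a \<Rightarrow> 'b) \<Rightarrow> 'a \<Rightarrow> 'b" where
  "scaleR_fun c f = (\<lambda>x. c *\<^sub>R f x)"

instance ..

end

instance "fun" :: (type, real_vector) real_vector
  by standard (simp_all add: fun_eq_iff scaleR_fun_def plus_fun_def algebra_simps)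


subsection \<open>Smooth manifolds\<close>

text \<open>
  On an open set \<open>S\<close>, \<open>C_on k S f\<close> says that \<open>f\<close> is \<open>k\<close> times continuously differentiable: its
  iterated partial derivatives of order less than \<open>k\<close> are differentiable and those of order \<open>k\<close>
  are continuous.
\<close>

primrec C_on :: "nat \<Rightarrow> 'e::euclidean_space set \<Rightarrow> ('e \<Rightarrow> 'f::real_normed_vector) \<Rightarrow> bool" where
  "C_on 0 S f \<longleftrightarrow> continuous_on S f"
| "C_on (Suc k) S f \<longleftrightarrow>
     f differentiable_on S \<and> (\<forall>i\<in>Basis. C_on k S (\<lambda>x. frechet_derivative f (at x) i))"

definition smooth_on :: "'e::euclidean_space set \<Rightarrow> ('e \<Rightarrow> 'f::real_normed_vector) \<Rightarrow> bool" where
  "smooth_on S f \<longleftrightarrow> (\<forall>k. C_on k S f)"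

text \<open>
  The points of the manifold are the elements of the (Hausdorff, second countable) type \<open>'a\<close>;
  a chart \<open>(U, x)\<close> has domain \<open>U\<close>, and the values of \<open>x\<close> outside \<open>U\<close> are irrelevant. The dimension
  of the manifold is \<open>DIM('e)\<close>. The atlas need not be maximal.
\<close>

type_synonym ('a, 'e) chart = "'a set \<times> ('a \<Rightarrow> 'e)"

definition smooth_manifold ::
  "('a::{t2_space, second_countable_topology}, 'e::euclidean_space) chart set \<Rightarrow> bool" where
  "smooth_manifold A \<longleftrightarrow>
     (\<Union>(U, x)\<in>A. U) = UNIV \<and>
     (\<forall>(U, x)\<in>A. open U \<and> open (x ` U) \<and> homeomorphism U (x ` U) x (inv_into U x)) \<and>
     (\<forall>(U, x)\<in>A. \<forall>(V, y)\<in>A. smooth_on (x ` (U \<inter> V)) (y \<circ> inv_into U x))"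

definition smooth_fun ::
  "('a::{t2_space, second_countable_topology}, 'e::euclidean_space) chart set \<Rightarrow> ('a \<Rightarrow> real) \<Rightarrow> bool"
  where
  "smooth_fun A f \<longleftrightarrow> (\<forall>(U, x)\<in>A. smooth_on (x ` U) (f \<circ> inv_into U x))"

text \<open>
  The tangent space at \<open>p\<close> consists of the directional derivatives at \<open>p\<close>, as operators on smooth
  functions. By the chain rule every chart around \<open>p\<close> yields the same operators. Tangent vectors
  vanish by convention on functions that are not smooth, so that equality in \<open>('a \<Rightarrow> real) \<Rightarrow> real\<close>
  is equality of tangent vectors.
\<close>

type_synonym 'a tvec = "('a \<Rightarrow> real) \<Rightarrow> real"
type_synonym 'a vfield = "'a \<Rightarrow> 'a tvec"

definition tangent_space ::
  "('a::{t2_space, second_countable_topology}, 'e::euclidean_space) chart set \<Rightarrow> 'a \<Rightarrow> 'a tvec set"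
  where
  "tangent_space A p =
     {v. \<exists>(U, x)\<in>A. p \<in> U \<and>
        (\<exists>w. v = (\<lambda>f. if smooth_fun A f
                       then frechet_derivative (f \<circ> inv_into U x) (at (x p)) w else 0))}"

definition deriv_along :: "'a vfield \<Rightarrow> ('a \<Rightarrow> real) \<Rightarrow> 'a \<Rightarrow> real" where
  "deriv_along X f = (\<lambda>p. X p f)"

definition vector_field ::
  "('a::{t2_space, second_countable_topology}, 'e::euclidean_space) chart set \<Rightarrow> 'a vfield \<Rightarrow> bool"
  where
  "vector_field A X \<longleftrightarrow>
     (\<forall>p. X p \<in> tangent_space A p) \<and> (\<forall>f. smooth_fun A f \<longrightarrow> smooth_fun A (deriv_along X f))"

definition lie_bracket :: "'a vfield \<Rightarrow> 'a vfield \<Rightarrow> 'a vfield" where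
  "lie_bracket X Y = (\<lambda>p f. X p (deriv_along Y f) - Y p (deriv_along X f))"

definition fscale :: "('a \<Rightarrow> real) \<Rightarrow> 'a vfield \<Rightarrow> 'a vfield"  (infixr \<open>\<odot>\<close> 75) where
  "f \<odot> X = (\<lambda>p. f p *\<^sub>R X p)"


subsection \<open>Tensor fields\<close>

text \<open>
  Tensor fields are smooth families of (multi)linear maps on the tangent spaces; only their values
  on tangent vectors matter. Smoothness is expressed by evaluation on vector fields.
\<close>

type_synonym 'a endo = "'a \<Rightarrow> 'a tvec \<Rightarrow> 'a tvec"
type_synonym 'a form1 = "'a \<Rightarrow> 'a tvec \<Rightarrow> real"
type_synonym 'a form2 = "'a \<Rightarrow> 'a tvec \<Rightarrow> 'a tvec \<Rightarrow> real"

text \<open>\<open>fapp \<phi> X\<close> is the vector field \<open>\<phi>X\<close>, and \<open>fapp \<eta> X\<close> the function \<open>\<eta>(X)\<close>.\<close>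

definition fapp :: "('a \<Rightarrow> 'b \<Rightarrow> 'c) \<Rightarrow> ('a \<Rightarrow> 'b) \<Rightarrow> 'a \<Rightarrow> 'c" where
  "fapp t X = (\<lambda>p. t p (X p))"

definition fapp2 :: "'a form2 \<Rightarrow> 'a vfield \<Rightarrow> 'a vfield \<Rightarrow> 'a \<Rightarrow> real" where
  "fapp2 g X Y = (\<lambda>p. g p (X p) (Y p))"

definition linear_on_tangent ::
  "('a::{t2_space, second_countable_topology}, 'e::euclidean_space) chart set \<Rightarrow> 'a \<Rightarrow>
   ('a tvec \<Rightarrow> 'b::real_vector) \<Rightarrow> bool" where
  "linear_on_tangent A p L \<longleftrightarrow>
     (\<forall>u\<in>tangent_space A p. \<forall>v\<in>tangent_space A p. L (u + v) = L u + L v) \<and>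
     (\<forall>c. \<forall>u\<in>tangent_space A p. L (c *\<^sub>R u) = c *\<^sub>R L u)"

definition endo_field ::
  "('a::{t2_space, second_countable_topology}, 'e::euclidean_space) chart set \<Rightarrow> 'a endo \<Rightarrow> bool" where
  "endo_field A \<phi> \<longleftrightarrow>
     (\<forall>p. linear_on_tangent A p (\<phi> p) \<and> \<phi> p ` tangent_space A p \<subseteq> tangent_space A p) \<and>
     (\<forall>X. vector_field A X \<longrightarrow> vector_field A (fapp \<phi> X))"

definition one_form ::
  "('a::{t2_space, second_countable_topology}, 'e::euclidean_space) chart set \<Rightarrow> 'a form1 \<Rightarrow> bool" where
  "one_form A \<eta> \<longleftrightarrow>
     (\<forall>p. linear_on_tangent A p (\<eta> p)) \<and>
     (\<forall>X. vector_field A X \<longrightarrow> smooth_fun A (fapp \<eta> X))"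

definition riemannian_metric ::
  "('a::{t2_space, second_countable_topology}, 'e::euclidean_space) chart set \<Rightarrow> 'a form2 \<Rightarrow> bool" where
  "riemannian_metric A g \<longleftrightarrow>
     (\<forall>p. \<forall>u\<in>tangent_space A p. linear_on_tangent A p (g p u)) \<and>
     (\<forall>p. \<forall>u\<in>tangent_space A p. \<forall>v\<in>tangent_space A p. g p u v = g p v u) \<and>
     (\<forall>p. \<forall>u\<in>tangent_space A p. u \<noteq> 0 \<longrightarrow> g p u u > 0) \<and>
     (\<forall>X Y. vector_field A X \<longrightarrow> vector_field A Y \<longrightarrow> smooth_fun A (fapp2 g X Y))"


subsection \<open>Connections and curvature\<close>

type_synonym 'a conn = "'a vfield \<Rightarrow> 'a vfield \<Rightarrow> 'a vfield"

definition linear_connection ::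
  "('a::{t2_space, second_countable_topology}, 'e::euclidean_space) chart set \<Rightarrow> 'a conn \<Rightarrow> bool" where
  "linear_connection A D \<longleftrightarrow>
     (\<forall>X Y. vector_field A X \<longrightarrow> vector_field A Y \<longrightarrow> vector_field A (D X Y)) \<and>
     (\<forall>X Y Z. vector_field A X \<longrightarrow> vector_field A Y \<longrightarrow> vector_field A Z \<longrightarrow>
        D (X + Y) Z = D X Z + D Y Z \<and> D X (Y + Z) = D X Y + D X Z) \<and>
     (\<forall>f X Y. smooth_fun A f \<longrightarrow> vector_field A X \<longrightarrow> vector_field A Y \<longrightarrow>
        D (f \<odot> X) Y = f \<odot> D X Y \<and> D X (f \<odot> Y) = deriv_along X f \<odot> Y + f \<odot> D X Y)"

definition metric_connection ::
  "('a::{t2_space, second_countable_topology}, 'e::euclidean_space) chart set \<Rightarrow> 'a form2 \<Rightarrow>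
   'a conn \<Rightarrow> bool" where
  "metric_connection A g D \<longleftrightarrow> linear_connection A D \<and>
     (\<forall>X Y Z. vector_field A X \<longrightarrow> vector_field A Y \<longrightarrow> vector_field A Z \<longrightarrow>
        deriv_along X (fapp2 g Y Z) = fapp2 g (D X Y) Z + fapp2 g Y (D X Z))"

definition torsion :: "'a conn \<Rightarrow> 'a vfield \<Rightarrow> 'a vfield \<Rightarrow> 'a vfield" where
  "torsion D X Y = D X Y - D Y X - lie_bracket X Y"

definition levi_civita ::
  "('a::{t2_space, second_countable_topology}, 'e::euclidean_space) chart set \<Rightarrow> 'a form2 \<Rightarrow>
   'a conn \<Rightarrow> bool" where
  "levi_civita A g D \<longleftrightarrow> metric_connection A g D \<and>
     (\<forall>X Y. vector_field A X \<longrightarrow> vector_field A Y \<longrightarrow> torsion D X Y = 0)"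

definition curvature :: "'a conn \<Rightarrow> 'a vfield \<Rightarrow> 'a vfield \<Rightarrow> 'a vfield \<Rightarrow> 'a vfield" where
  "curvature D X Y Z = D X (D Y Z) - D Y (D X Z) - D (lie_bracket X Y) Z"

text \<open>The trace of a linear endomorphism of the tangent space, computed in some basis.\<close>

definition tangent_trace ::
  "('a::{t2_space, second_countable_topology}, 'e::euclidean_space) chart set \<Rightarrow> 'a \<Rightarrow>
   ('a tvec \<Rightarrow> 'a tvec) \<Rightarrow> real" where
  "tangent_trace A p L =
     (let B = (SOME B. independent B \<and> span B = tangent_space A p)
      in \<Sum>b\<in>B. representation B (L b) b)"

text \<open>
  Since the curvature is tensorial, its value at \<open>p\<close> depends only on the value \<open>v\<close> at \<open>p\<close> of its
  first argument, so any vector field extending \<open>v\<close> may be used.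
\<close>

definition ricci ::
  "('a::{t2_space, second_countable_topology}, 'e::euclidean_space) chart set \<Rightarrow> 'a conn \<Rightarrow>
   'a vfield \<Rightarrow> 'a vfield \<Rightarrow> 'a \<Rightarrow> real" where
  "ricci A D Y Z = (\<lambda>p. tangent_trace A p
     (\<lambda>v. curvature D (SOME X. vector_field A X \<and> X p = v) Y Z p))"


subsection \<open>Kenmotsu manifolds and generalized symmetric metric connections\<close>

definition almost_contact_metric ::
  "('a::{t2_space, second_countable_topology}, 'e::euclidean_space) chart set \<Rightarrow>
   'a endo \<Rightarrow> 'a vfield \<Rightarrow> 'a form1 \<Rightarrow> 'a form2 \<Rightarrow> bool" where
  "almost_contact_metric A \<phi> \<xi> \<eta> g \<longleftrightarrow>
     smooth_manifold A \<and> odd DIM('e) \<and>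
     endo_field A \<phi> \<and> vector_field A \<xi> \<and> one_form A \<eta> \<and> riemannian_metric A g \<and>
     (\<forall>p. \<phi> p (\<xi> p) = 0 \<and> \<eta> p (\<xi> p) = 1 \<and>
       (\<forall>u\<in>tangent_space A p.
          \<eta> p (\<phi> p u) = 0 \<and>
          \<phi> p (\<phi> p u) = - u + \<eta> p u *\<^sub>R \<xi> p \<and>
          g p u (\<xi> p) = \<eta> p u \<and>
          (\<forall>v\<in>tangent_space A p. g p (\<phi> p u) (\<phi> p v) = g p u v - \<eta> p u * \<eta> p v)))"

definition kenmotsu ::
  "('a::{t2_space, second_countable_topology}, 'e::euclidean_space) chart set \<Rightarrow>
   'a endo \<Rightarrow> 'a vfield \<Rightarrow> 'a form1 \<Rightarrow> 'a form2 \<Rightarrow> 'a conn \<Rightarrow> bool" where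
  "kenmotsu A \<phi> \<xi> \<eta> g N \<longleftrightarrow>
     almost_contact_metric A \<phi> \<xi> \<eta> g \<and> levi_civita A g N \<and>
     (\<forall>X Y. vector_field A X \<longrightarrow> vector_field A Y \<longrightarrow>
        N X (fapp \<phi> Y) - fapp \<phi> (N X Y) =
          fapp2 g (fapp \<phi> X) Y \<odot> \<xi> - fapp \<eta> Y \<odot> fapp \<phi> X) \<and>
     (\<forall>X. vector_field A X \<longrightarrow> N X \<xi> = X - fapp \<eta> X \<odot> \<xi>)"

definition generalized_symmetric_metric_connection ::
  "('a::{t2_space, second_countable_topology}, 'e::euclidean_space) chart set \<Rightarrow>
   'a endo \<Rightarrow> 'a form1 \<Rightarrow> 'a form2 \<Rightarrow> ('a \<Rightarrow> real) \<Rightarrow> ('a \<Rightarrow> real) \<Rightarrow> 'a conn \<Rightarrow> bool" where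
  "generalized_symmetric_metric_connection A \<phi> \<eta> g \<alpha> \<beta> D \<longleftrightarrow>
     smooth_fun A \<alpha> \<and> smooth_fun A \<beta> \<and> metric_connection A g D \<and>
     (\<forall>X Y. vector_field A X \<longrightarrow> vector_field A Y \<longrightarrow>
        torsion D X Y =
          \<alpha> \<odot> (fapp \<eta> Y \<odot> X - fapp \<eta> X \<odot> Y) +
          \<beta> \<odot> (fapp \<eta> Y \<odot> fapp \<phi> X - fapp \<eta> X \<odot> fapp \<phi> Y))"

text \<open>
  As is customary for these solitons, the Lie derivative of \<open>g\<close> along \<open>\<xi>\<close> is replaced by its
  expression in terms of the connection \<open>D\<close>; if \<open>D\<close> has torsion, this need not be the Lie
  derivative itself.
\<close>

definition eta_ricci_soliton ::
  "('a::{t2_space, second_countable_topology}, 'e::euclidean_space) chart set \<Rightarrow>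
   'a vfield \<Rightarrow> 'a form1 \<Rightarrow> 'a form2 \<Rightarrow> 'a conn \<Rightarrow> real \<Rightarrow> real \<Rightarrow> bool" where
  "eta_ricci_soliton A \<xi> \<eta> g D l \<mu> \<longleftrightarrow>
     (\<forall>X Y. vector_field A X \<longrightarrow> vector_field A Y \<longrightarrow>
       (\<forall>p. 2 * ricci A D X Y p =
          - fapp2 g (D X \<xi>) Y p - fapp2 g X (D Y \<xi>) p
          - 2 * l * fapp2 g X Y p - 2 * \<mu> * fapp \<eta> X p * fapp \<eta> Y p))"

definition ricci_dot_curvature_zero ::
  "('a::{t2_space, second_countable_topology}, 'e::euclidean_space) chart set \<Rightarrow>
   'a vfield \<Rightarrow> 'a conn \<Rightarrow> bool" where
  "ricci_dot_curvature_zero A \<xi> D \<longleftrightarrow>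
     (let R = curvature D; S = ricci A D in
      \<forall>X Y Z W. vector_field A X \<longrightarrow> vector_field A Y \<longrightarrow> vector_field A Z \<longrightarrow> vector_field A W \<longrightarrow>
        S X (R Y Z W) \<odot> \<xi> - S \<xi> (R Y Z W) \<odot> X
        + S X Y \<odot> R \<xi> Z W - S \<xi> Y \<odot> R X Z W
        + S X Z \<odot> R Y \<xi> W - S \<xi> Z \<odot> R Y X W
        + S X W \<odot> R Y Z \<xi> - S \<xi> W \<odot> R Y Z X = 0)"

end

theory Submission
  imports Defs
begin

text \<open>
  Write \<open>a = \<alpha> + 1\<close> and \<open>\<rho> = 2\<lambda> + \<mu> + a\<close>. The Koszul formula gives \<open>D\<^sub>X \<xi> = a (X - \<eta>(X) \<xi>)\<close>, so the
  soliton equation reads \<open>S = - (a + \<lambda>) g + (a - \<mu>) \<eta> \<otimes> \<eta>\<close>. Taking the \<open>\<xi>\<close>-component of the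
  curvature condition with \<open>W = \<xi>\<close> and \<open>X = R(Y,Z)\<xi>\<close> yields \<open>\<rho> |R(Y,Z)\<xi>|\<^sup>2 = 0\<close>.
  Suppose \<open>\<rho> \<noteq> 0\<close> at a point. Then \<open>R(Y,Z)\<xi> = 0\<close> there, hence \<open>S(\<xi>,\<xi>) = 0\<close>, i.e. \<open>\<lambda> + \<mu> = 0\<close>. The
  \<open>\<xi>\<close>-component for general \<open>W\<close>, with \<open>X = R(Y,Z)W\<close>, now gives \<open>\<rho> |R(Y,Z)W|\<^sup>2 = 0\<close>, so \<open>R\<close>
  and with it \<open>S = - \<rho> (g - \<eta> \<otimes> \<eta>)\<close> vanish at the point, a contradiction. So \<open>\<rho> = 0\<close>
  everywhere, and no derivative of \<open>\<alpha>\<close> or \<open>\<beta>\<close> has to be computed. Bump functions extend tangent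
  vectors to vector fields, without which the trace defining \<open>S\<close> says nothing about \<open>R\<close>.
\<close>

subsection \<open>Smooth functions on Euclidean spaces\<close>

lemma C_on_SucI:
  assumes "open S" "\<And>x. x \<in> S \<Longrightarrow> (f has_derivative f' x) (at x)"
    and "\<And>i. i \<in> Basis \<Longrightarrow> C_on k S (\<lambda>x. frechet_derivative f (at x) i)"
  shows "C_on (Suc k) S f"
  using assms by (auto simp: differentiable_on_eq_differentiable_at intro: differentiableI)

lemma C_on_Suc_has_derivative:
  assumes "open S" "C_on (Suc k) S f" "x \<in> S"
  shows "(f has_derivative frechet_derivative f (at x)) (at x)"
  using assms by (auto simp: differentiable_on_eq_differentiable_at frechet_derivative_works)

text \<open>On an open set, functions that agree have the same derivatives, so values outside
  \<open>S\<close> never matter. Inverse charts are arbitrary off the chart image, which makes this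
  indispensable.\<close>

lemma C_on_cong:
  assumes "open S" "\<And>x. x \<in> S \<Longrightarrow> f x = g x" "C_on k S f"
  shows "C_on k S g"
  using assms
proof (induction k arbitrary: f g)
  case 0
  then show ?case by (simp cong: continuous_on_cong)
next
  case (Suc k)
  have d: "(g has_derivative frechet_derivative f (at x)) (at x)" if "x \<in> S" for x
    using has_derivative_transform_within_open[OF C_on_Suc_has_derivative[OF Suc.prems(1,3) that]
        Suc.prems(1) that Suc.prems(2)] .
  have "C_on k S (\<lambda>x. frechet_derivative g (at x) i)" if "i \<in> Basis" for i
  proof (rule Suc.IH[OF Suc.prems(1)])
    show "C_on k S (\<lambda>x. frechet_derivative f (at x) i)" using Suc.prems(3) that by simp
    show "frechet_derivative f (at x) i = frechet_derivative g (at x) i" if "x \<in> S" for x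
      using frechet_derivative_at[OF d[OF that]] by simp
  qed
  with d show ?case by (rule C_on_SucI[OF Suc.prems(1)])
qed

text \<open>Uniqueness of the derivative lets an explicit formula \<open>f'\<close> stand in for
  \<open>frechet_derivative\<close>; most closure lemmas below feed a differentiation rule into this
  form.\<close>

lemma C_on_SucI':
  assumes "open S" "\<And>x. x \<in> S \<Longrightarrow> (f has_derivative f' x) (at x)"
    and "\<And>i. i \<in> Basis \<Longrightarrow> C_on k S (\<lambda>x. f' x i)"
  shows "C_on (Suc k) S f"
proof (rule C_on_SucI[OF assms(1,2)])
  fix i :: 'a assume "i \<in> Basis"
  then show "C_on k S (\<lambda>x. frechet_derivative f (at x) i)"
    using frechet_derivative_at[OF assms(2)] by (intro C_on_cong[OF assms(1) _ assms(3)[of i]]) simp_all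
qed

lemma C_on_Suc_imp: "C_on (Suc k) S f \<Longrightarrow> C_on k S f"
  by (induction k arbitrary: f) (auto intro: differentiable_imp_continuous_on)

lemma C_on_subset: "C_on k S f \<Longrightarrow> T \<subseteq> S \<Longrightarrow> C_on k T f"
  by (induction k arbitrary: f) (auto intro: continuous_on_subset differentiable_on_subset)

lemma C_on_Un:
  assumes "open S" "open T" "C_on k S f" "C_on k T f"
  shows "C_on k (S \<union> T) f"
  using assms
  by (induction k arbitrary: f)
    (auto intro: continuous_on_open_Un simp: differentiable_on_eq_differentiable_at open_Un)

lemma C_on_const: "open S \<Longrightarrow> C_on k S (\<lambda>x. c)"
  by (induction k arbitrary: c) (auto intro!: C_on_SucI'[OF _ has_derivative_const] simp del: C_on.simps(2))

lemma C_on_bounded_linear: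
  assumes "bounded_linear L" "open S" "C_on k S f"
  shows "C_on k S (\<lambda>x. L (f x))"
  using assms(3)
proof (induction k arbitrary: f)
  case 0
  then show ?case using assms by (auto intro: bounded_linear.continuous_on)
next
  case (Suc k)
  show ?case
    using Suc.prems
    by (intro C_on_SucI'[OF assms(2) bounded_linear.has_derivative[OF assms(1)
        C_on_Suc_has_derivative[OF assms(2) Suc.prems]]] Suc.IH) auto
qed

lemma C_on_add:
  assumes "open S" "C_on k S f" "C_on k S g"
  shows "C_on k S (\<lambda>x. f x + g x)"
  using assms(2,3)
proof (induction k arbitrary: f g)
  case 0
  then show ?case by (auto intro: continuous_intros)
next
  case (Suc k)
  show ?case
    using Suc.prems
    by (intro C_on_SucI'[OF assms(1) has_derivative_add[OF
        C_on_Suc_has_derivative[OF assms(1) Suc.prems(1)] C_on_Suc_has_derivative[OF assms(1) Suc.prems(2)]]]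
        Suc.IH) auto
qed

lemma C_on_sum:
  assumes "open S" "\<And>j. j \<in> J \<Longrightarrow> C_on k S (f j)"
  shows "C_on k S (\<lambda>x. \<Sum>j\<in>J. f j x)"
  using assms(2) by (induction J rule: infinite_finite_induct) (auto intro: C_on_const C_on_add assms(1))

lemma C_on_scaleR:
  assumes "open S" "C_on k S f" "C_on k S g"
  shows "C_on k S (\<lambda>x. f x *\<^sub>R g x)"
  using assms(2,3)
proof (induction k arbitrary: f g)
  case 0
  then show ?case by (auto intro: continuous_intros)
next
  case (Suc k)
  note d = C_on_Suc_has_derivative[OF assms(1) Suc.prems(1)]
    C_on_Suc_has_derivative[OF assms(1) Suc.prems(2)]
  \<comment> \<open>The product rule pairs each derivative with the other factor undifferentiated,
    which has to be lowered from order \<open>Suc k\<close> to \<open>k\<close>.\<close>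
  show ?case
    using Suc.prems by (intro C_on_SucI'[OF assms(1) has_derivative_scaleR[OF d]] C_on_add Suc.IH assms(1)
        C_on_Suc_imp[of k S f] C_on_Suc_imp[of k S g]) auto
qed

lemma C_on_ident: "open S \<Longrightarrow> C_on k S (\<lambda>x. x)"
proof (cases k)
  case (Suc m)
  assume "open S"
  then show ?thesis unfolding Suc by (intro C_on_SucI'[OF _ has_derivative_ident] C_on_const)
qed simp

text \<open>Expanding the chain rule in the basis writes the partial derivatives of the composition
  as sums of products of a partial derivative of \<open>f\<close>, composed with \<open>h\<close>,
  and a component of a partial derivative of \<open>h\<close>. The induction therefore keeps
  \<open>h\<close> and generalises \<open>f\<close>.\<close>

lemma C_on_compose:
  fixes f :: "'e::euclidean_space \<Rightarrow> 'f::real_normed_vector" and h :: "'d::euclidean_space \<Rightarrow> 'e"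
  assumes "open S" "open T" "h ` S \<subseteq> T" "C_on k T f" "C_on k S h"
  shows "C_on k S (\<lambda>x. f (h x))"
  using assms(4,5)
proof (induction k arbitrary: f)
  case 0
  then show ?case using assms(3) by (auto intro: continuous_on_compose2)
next
  case (Suc k)
  note df = C_on_Suc_has_derivative[OF assms(2) Suc.prems(1)]
  note dh = C_on_Suc_has_derivative[OF assms(1) Suc.prems(2)]
  let ?f = "\<lambda>y. frechet_derivative f (at y)" and ?h = "\<lambda>x. frechet_derivative h (at x)"
  show ?case
  proof (rule C_on_SucI'[OF assms(1)])
    fix x assume x: "x \<in> S"
    with assms(3) have "h x \<in> T" by auto
    from has_derivative_compose[OF dh[OF x] df[OF this]]
    show "((\<lambda>x. f (h x)) has_derivative
       (\<lambda>v. \<Sum>j\<in>Basis. (?h x v \<bullet> j) *\<^sub>R ?f (h x) j)) (at x)"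
    proof (rule has_derivative_eq_rhs, intro ext)
      fix v
      have "linear (?f (h x))"
        using df[OF \<open>h x \<in> T\<close>] has_derivative_linear by blast
      then have "?f (h x) (\<Sum>j\<in>Basis. (?h x v \<bullet> j) *\<^sub>R j) = (\<Sum>j\<in>Basis. (?h x v \<bullet> j) *\<^sub>R ?f (h x) j)"
        by (simp add: linear_sum linear_scale)
      then show "?f (h x) (?h x v) = (\<Sum>j\<in>Basis. (?h x v \<bullet> j) *\<^sub>R ?f (h x) j)"
        by (simp add: euclidean_representation)
    qed
  next
    fix i :: 'd assume "i \<in> Basis"
    with Suc.prems show "C_on k S (\<lambda>x. \<Sum>j\<in>Basis. (?h x i \<bullet> j) *\<^sub>R ?f (h x) j)"
      by (intro C_on_sum C_on_scaleR C_on_bounded_linear[OF bounded_linear_inner_left]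
          Suc.IH[of "\<lambda>y. frechet_derivative f (at y) _"] assms(1) C_on_Suc_imp[of k S h]) auto
  qed
qed

lemma smooth_on_cong:
  "open S \<Longrightarrow> smooth_on S f \<Longrightarrow> (\<And>x. x \<in> S \<Longrightarrow> f x = g x) \<Longrightarrow> smooth_on S g"
  unfolding smooth_on_def by (auto intro: C_on_cong[of S f g])

lemma smooth_on_imp_has_derivative:
  assumes "open S" "smooth_on S f" "x \<in> S"
  shows "(f has_derivative frechet_derivative f (at x)) (at x)"
  using assms C_on_Suc_has_derivative[of S 0 f x] unfolding smooth_on_def by blast

lemma smooth_on_const: "open S \<Longrightarrow> smooth_on S (\<lambda>x. c)"
  and smooth_on_add: "open S \<Longrightarrow> smooth_on S u \<Longrightarrow> smooth_on S v \<Longrightarrow> smooth_on S (\<lambda>x. u x + v x)"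
  and smooth_on_scaleR: "open S \<Longrightarrow> smooth_on S f \<Longrightarrow> smooth_on S u \<Longrightarrow> smooth_on S (\<lambda>x. f x *\<^sub>R u x)"
  unfolding smooth_on_def by (auto intro: C_on_const C_on_add C_on_scaleR)

text \<open>
  This family of flat functions contains \<open>t \<mapsto> exp (- 1 / t)\<close> and is closed under differentiation
  up to linear combinations, so smoothness follows by induction on the order.
\<close>

definition flat :: "nat \<Rightarrow> real \<Rightarrow> real" where
  "flat n t = (if t > 0 then exp (- inverse t) * inverse t ^ n else 0)"

text \<open>From the right, substitute \<open>s = inverse t\<close> and use that
  \<open>exp s\<close> outgrows \<open>s ^ n\<close>; from the left the function is zero.\<close>

lemma flat_tendsto_0: "(flat n \<longlongrightarrow> 0) (at 0)"
proof (rule filterlim_split_at)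
  have "((\<lambda>t. inverse t ^ n / exp (inverse t)) \<longlongrightarrow> (0::real)) (at_right 0)"
    by (rule filterlim_compose[OF tendsto_power_div_exp_0 filterlim_inverse_at_top_right])
  moreover have "\<forall>\<^sub>F t in at_right 0. inverse t ^ n / exp (inverse t) = flat n t"
    unfolding eventually_at_right_field
    by (intro exI[of _ 1]) (auto simp: flat_def exp_minus divide_inverse)
  ultimately show "(flat n \<longlongrightarrow> 0) (at_right 0)"
    by (rule Lim_transform_eventually)
  have "\<forall>\<^sub>F t in at_left 0. 0 = flat n t"
    unfolding eventually_at_left_field by (intro exI[of _ "-1"]) (auto simp: flat_def)
  then show "(flat n \<longlongrightarrow> 0) (at_left 0)"
    by (rule Lim_transform_eventually[OF tendsto_const])
qed

lemma DERIV_flat: "(flat n has_field_derivative flat (n + 2) t - n * flat (n + 1) t) (at t)"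
proof -
  consider "t > 0" | "t < 0" | "t = 0" by linarith
  then show ?thesis
  proof cases
    case 1
    have "((\<lambda>t. exp (- inverse t) * inverse t ^ n) has_field_derivative
        exp (- inverse t) * (inverse t * inverse t) * inverse t ^ n
        + (n * (- (inverse t * inverse t)) * inverse t ^ (n - 1)) * exp (- inverse t)) (at t)"
      using 1 by (auto intro!: derivative_eq_intros)
    then have "((\<lambda>t. exp (- inverse t) * inverse t ^ n) has_field_derivative
        flat (n + 2) t - n * flat (n + 1) t) (at t)"
      using 1 by (cases n) (simp_all add: flat_def algebra_simps)
    from has_field_derivative_transform_within_open[OF this, of "{0<..}"] 1 show ?thesis
      by (auto simp: flat_def)
  next
    case 2
    have "((\<lambda>t. 0) has_field_derivative flat (n + 2) t - n * flat (n + 1) t) (at t)"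
      using 2 by (auto simp: flat_def)
    from has_field_derivative_transform_within_open[OF this, of "{..<0}"] 2 show ?thesis
      by (auto simp: flat_def)
  next
    case 3
    \<comment> \<open>At 0 the difference quotient of \<open>flat n\<close> is exactly
      \<open>flat (n + 1)\<close>, and the claimed derivative is 0.\<close>
    have "\<forall>\<^sub>F h in at 0. flat (n + 1) h = (flat n (0 + h) - flat n 0) / h"
      unfolding eventually_at by (intro exI[of _ 1]) (auto simp: flat_def divide_inverse)
    from Lim_transform_eventually[OF flat_tendsto_0 this] show ?thesis
      unfolding 3 DERIV_def by (simp add: flat_def)
  qed
qed

lemma smooth_flat: "smooth_on UNIV (flat n)"
proof -
  have "C_on k UNIV (flat n)" for k
  proof (induction k arbitrary: n)
    case 0
    show ?case unfolding C_on.simps by (rule DERIV_continuous_on[OF DERIV_flat])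
  next
    case (Suc k)
    have c: "C_on k UNIV (\<lambda>t. (flat (n + 2) t + (- real n) *\<^sub>R flat (n + 1) t) *\<^sub>R i)" for i :: real
      by (intro C_on_scaleR C_on_add C_on_const Suc.IH open_UNIV)
    have "(flat n has_derivative (\<lambda>v. (flat (n + 2) t + (- real n) *\<^sub>R flat (n + 1) t) *\<^sub>R v)) (at t)" for t
      using DERIV_flat[of n t] unfolding has_field_derivative_def
      by (rule has_derivative_eq_rhs) (auto simp: fun_eq_iff)
    then show ?case by (rule C_on_SucI'[OF open_UNIV _ c])
  qed
  then show ?thesis by (simp add: smooth_on_def)
qed

lemma smooth_bump_exists:
  fixes c :: "'e::euclidean_space"
  assumes "r > 0"
  obtains b :: "'e \<Rightarrow> real" where "smooth_on UNIV b" "b c = 1" "\<And>z. r \<le> dist c z \<Longrightarrow> b z = 0"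
proof
  \<comment> \<open>\<open>?q z\<close> is \<open>r\<^sup>2\<close> minus the squared distance to
    \<open>c\<close>, spelled out in coordinates so that the closure lemmas apply. It is at most 0
    outside the open ball, where \<open>flat 0\<close> vanishes; the constant factor in
    \<open>?b\<close> normalises the value at \<open>c\<close> to 1.\<close>
  let ?q = "\<lambda>z. r\<^sup>2 + (- 1) *\<^sub>R (\<Sum>j\<in>Basis. ((z + (- c)) \<bullet> j) *\<^sub>R ((z + (- c)) \<bullet> j))"
  let ?b = "\<lambda>z. flat 0 (?q z) *\<^sub>R inverse (flat 0 (r\<^sup>2))"
  have "C_on k UNIV ?b" for k
  proof (intro C_on_scaleR C_on_const open_UNIV)
    have "C_on k UNIV ?q"
      by (intro C_on_scaleR C_on_const C_on_add C_on_sum C_on_ident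
          C_on_bounded_linear[OF bounded_linear_inner_left] open_UNIV)
    with smooth_flat[of 0] show "C_on k UNIV (\<lambda>z. flat 0 (?q z))"
      unfolding smooth_on_def
      using C_on_compose[OF open_UNIV open_UNIV subset_UNIV, of k "flat 0"] by blast
  qed
  then show "smooth_on UNIV ?b" by (simp add: smooth_on_def)
  show "?b c = 1" using assms by (simp add: flat_def)
  fix z assume "r \<le> dist c z"
  then have "r\<^sup>2 \<le> (norm (z - c))\<^sup>2"
    using assms by (intro power_mono) (auto simp: dist_norm norm_minus_commute)
  also have "\<dots> = (\<Sum>j\<in>Basis. ((z + (- c)) \<bullet> j) *\<^sub>R ((z + (- c)) \<bullet> j))"
    unfolding power2_norm_eq_inner by (subst euclidean_inner) simp
  finally show "?b z = 0" by (simp add: flat_def)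
qed


subsection \<open>Tangent vectors and vector fields\<close>

text \<open>The tangent vector with coordinates \<open>w\<close> in the chart. As a function of
  \<open>w\<close> it turns out to be a linear isomorphism onto the tangent space.\<close>

definition chart_vector ::
  "('a::{t2_space, second_countable_topology}, 'e::euclidean_space) chart set \<Rightarrow>
   'a set \<Rightarrow> ('a \<Rightarrow> 'e) \<Rightarrow> 'a \<Rightarrow> 'e \<Rightarrow> 'a tvec" where
  "chart_vector A U x p w =
     (\<lambda>f. if smooth_fun A f then frechet_derivative (f \<circ> inv_into U x) (at (x p)) w else 0)"

locale manifold =
  fixes A :: "('a::{t2_space, second_countable_topology}, 'e::euclidean_space) chart set"
  assumes smooth_manifold: "smooth_manifold A"
begin

section \<open>Charts and smooth functions\<close>

lemma chart_exists: obtains U x where "(U, x) \<in> A" "p \<in> U"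
proof -
  have "p \<in> (\<Union>(U, x)\<in>A. U)" using smooth_manifold by (simp add: smooth_manifold_def)
  then show thesis using that by auto
qed

lemma chart_domain_open: "(U, x) \<in> A \<Longrightarrow> open U"
  and chart_image_open: "(U, x) \<in> A \<Longrightarrow> open (x ` U)"
  and chart_homeomorphism: "(U, x) \<in> A \<Longrightarrow> homeomorphism U (x ` U) x (inv_into U x)"
  and transition_smooth:
    "(U, x) \<in> A \<Longrightarrow> (V, y) \<in> A \<Longrightarrow> smooth_on (x ` (U \<inter> V)) (y \<circ> inv_into U x)"
  using smooth_manifold unfolding smooth_manifold_def by fast+

lemma chart_inverse: "(U, x) \<in> A \<Longrightarrow> p \<in> U \<Longrightarrow> inv_into U x (x p) = p"
  using chart_homeomorphism by (auto simp: homeomorphism_def)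

lemma open_chart_image: "(U, x) \<in> A \<Longrightarrow> open W \<Longrightarrow> open (x ` (U \<inter> W))"
  using homeomorphism_imp_open_map[OF chart_homeomorphism[of U x], of "U \<inter> W"] chart_image_open[of U x]
  by (auto simp: openin_open_eq)

lemma smooth_funD: "smooth_fun A f \<Longrightarrow> (U, x) \<in> A \<Longrightarrow> smooth_on (x ` U) (f \<circ> inv_into U x)"
  by (auto simp: smooth_fun_def)

lemma smooth_fun_add: "smooth_fun A f \<Longrightarrow> smooth_fun A h \<Longrightarrow> smooth_fun A (\<lambda>p. f p + h p)"
  using smooth_on_add[OF chart_image_open] unfolding smooth_fun_def comp_def by fast

lemma smooth_fun_mult: "smooth_fun A f \<Longrightarrow> smooth_fun A h \<Longrightarrow> smooth_fun A (\<lambda>p. f p * h p)"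
  using smooth_on_scaleR[OF chart_image_open, where u = "_ :: 'e \<Rightarrow> real"]
  unfolding smooth_fun_def comp_def real_scaleR_def by fast

lemma smooth_fun_const: "smooth_fun A (\<lambda>p. c)"
  using smooth_on_const[OF chart_image_open] unfolding smooth_fun_def comp_def by fast

lemma smooth_fun_has_derivative:
  "smooth_fun A f \<Longrightarrow> (U, x) \<in> A \<Longrightarrow> p \<in> U \<Longrightarrow>
    (f \<circ> inv_into U x has_derivative frechet_derivative (f \<circ> inv_into U x) (at (x p))) (at (x p))"
  using smooth_on_imp_has_derivative[OF chart_image_open smooth_funD] by blast

lemma linear_chart_vector:
  assumes "(U, x) \<in> A" "p \<in> U"
  shows "linear (chart_vector A U x p)"
proof -
  have "linear (frechet_derivative (f \<circ> inv_into U x) (at (x p)))" if "smooth_fun A f" for f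
    using has_derivative_linear[OF smooth_fun_has_derivative[OF that assms]] .
  then show ?thesis
    by (intro linearI) (auto simp: chart_vector_def fun_eq_iff scaleR_fun_def linear_add linear_scale)
qed

text \<open>Chain rule: coordinates transform by the Jacobian of the transition map.\<close>

lemma chart_vector_change:
  assumes x: "(U, x) \<in> A" "p \<in> U" and y: "(V, y) \<in> A" "p \<in> V"
  shows "chart_vector A V y p w =
    chart_vector A U x p (frechet_derivative (x \<circ> inv_into V y) (at (y p)) w)"
proof
  fix f
  let ?t = "x \<circ> inv_into V y"
  have "frechet_derivative (f \<circ> inv_into V y) (at (y p)) w =
     frechet_derivative (f \<circ> inv_into U x) (at (x p)) (frechet_derivative ?t (at (y p)) w)"
    if f: "smooth_fun A f"
  proof -
    have o: "open (y ` (V \<inter> U))"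
      using y(1) chart_domain_open[OF x(1)] by (rule open_chart_image)
    have yp: "y p \<in> y ` (V \<inter> U)" using x y by blast
    have "(?t has_derivative frechet_derivative ?t (at (y p))) (at (y p))"
      using o transition_smooth[OF y(1) x(1)] yp by (rule smooth_on_imp_has_derivative)
    moreover have "(f \<circ> inv_into U x has_derivative frechet_derivative (f \<circ> inv_into U x) (at (x p))) (at (?t (y p)))"
      using smooth_fun_has_derivative[OF f x] by (simp add: chart_inverse[OF y])
    ultimately have "(f \<circ> inv_into U x \<circ> ?t has_derivative
        frechet_derivative (f \<circ> inv_into U x) (at (x p)) \<circ> frechet_derivative ?t (at (y p))) (at (y p))"
      by (rule diff_chain_at)
    \<comment> \<open>The factorisation through the transition map holds only over the overlap of
      the charts, whose image is open.\<close>
    then have "(f \<circ> inv_into V y has_derivative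
        frechet_derivative (f \<circ> inv_into U x) (at (x p)) \<circ> frechet_derivative ?t (at (y p))) (at (y p))"
      using o yp
      by (rule has_derivative_transform_within_open)
        (auto simp: chart_inverse[OF x(1)] chart_inverse[OF y(1)])
    then show ?thesis using frechet_derivative_at by (metis comp_apply)
  qed
  then show "chart_vector A V y p w f =
    chart_vector A U x p (frechet_derivative ?t (at (y p)) w) f"
    by (simp add: chart_vector_def)
qed

text \<open>The definition admits every chart around \<open>p\<close>; the change of charts reduces
  it to a single one, so the tangent space is a linear image and hence a subspace.\<close>

lemma tangent_space_eq_range:
  assumes "(U, x) \<in> A" "p \<in> U"
  shows "tangent_space A p = range (chart_vector A U x p)"
proof
  show "range (chart_vector A U x p) \<subseteq> tangent_space A p"
    using assms unfolding tangent_space_def chart_vector_def by blast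
  show "tangent_space A p \<subseteq> range (chart_vector A U x p)"
  proof
    fix v assume "v \<in> tangent_space A p"
    then obtain V y w where "(V, y) \<in> A" "p \<in> V" "v = chart_vector A V y p w"
      unfolding tangent_space_def chart_vector_def by blast
    with chart_vector_change[OF assms] show "v \<in> range (chart_vector A U x p)" by blast
  qed
qed

lemma subspace_tangent_space: "subspace (tangent_space A p)"
proof -
  obtain U x where "(U, x) \<in> A" "p \<in> U" by (rule chart_exists)
  then show ?thesis
    using linear_subspace_image[OF linear_chart_vector subspace_UNIV] tangent_space_eq_range by metis
qed

lemmas tangent_add = subspace_add[OF subspace_tangent_space]
  and tangent_scale = subspace_scale[OF subspace_tangent_space]
  and tangent_diff = subspace_diff[OF subspace_tangent_space]

text \<open>Additivity of the derivative. It is stated for smooth functions because tangent vectors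
  are set to 0 on all others.\<close>

lemma tangent_vector_add:
  assumes "v \<in> tangent_space A p" "smooth_fun A f" "smooth_fun A h"
  shows "v (\<lambda>q. f q + h q) = v f + v h"
proof -
  obtain U x where c: "(U, x) \<in> A" "p \<in> U" by (rule chart_exists)
  then obtain w where v: "v = chart_vector A U x p w"
    using assms(1) tangent_space_eq_range by blast
  note d = has_derivative_add[OF smooth_fun_has_derivative[OF assms(2) c] smooth_fun_has_derivative[OF assms(3) c]]
  have "(\<lambda>q. f q + h q) \<circ> inv_into U x = (\<lambda>q. (f \<circ> inv_into U x) q + (h \<circ> inv_into U x) q)"
    by auto
  then show ?thesis
    using frechet_derivative_at[OF d, symmetric] assms smooth_fun_add[OF assms(2,3)]
    by (simp add: v chart_vector_def)
qed

text \<open>Any other chart image is covered by two open pieces: over \<open>U\<close> smoothness is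
  inherited through the transition map, and over the complement of the closed set \<open>K\<close>
  the function is 0.\<close>

lemma smooth_fun_extend:
  assumes c: "(U, x) \<in> A" and K: "closed K" "K \<subseteq> U" and F: "smooth_on (x ` U) (F \<circ> inv_into U x)"
    and 0: "\<And>q. q \<notin> K \<Longrightarrow> F q = 0"
  shows "smooth_fun A F"
  unfolding smooth_fun_def
proof (intro ballI, safe)
  fix V y assume V: "(V, y) \<in> A"
  have o: "open (y ` (V \<inter> U))" "open (y ` (V \<inter> - K))"
    using V chart_domain_open[OF c] K by (auto intro: open_chart_image)
  have "smooth_on (y ` (V \<inter> U)) (\<lambda>z. (F \<circ> inv_into U x) ((x \<circ> inv_into V y) z))"
    using C_on_compose[OF o(1) chart_image_open[OF c], of "x \<circ> inv_into V y"] F transition_smooth[OF V c]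
    unfolding smooth_on_def by (force simp: chart_inverse[OF V])
  with o(1) have 1: "smooth_on (y ` (V \<inter> U)) (F \<circ> inv_into V y)"
    by (rule smooth_on_cong) (auto simp: chart_inverse[OF V] chart_inverse[OF c])
  have "smooth_on (y ` (V \<inter> - K)) (\<lambda>z. 0 :: real)"
    using o(2) by (rule smooth_on_const)
  with o(2) have 2: "smooth_on (y ` (V \<inter> - K)) (F \<circ> inv_into V y)"
    by (rule smooth_on_cong) (auto simp: chart_inverse[OF V] 0)
  have "y ` V = y ` (V \<inter> U) \<union> y ` (V \<inter> - K)"
    using K by blast
  with C_on_Un[OF o] 1 2 show "smooth_on (y ` V) (F \<circ> inv_into V y)"
    unfolding smooth_on_def by metis
qed

text \<open>\<open>K\<close> corresponds to a closed ball inside the chart image. It is compact,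
  hence closed in the whole Hausdorff manifold and not only in \<open>U\<close>.\<close>

lemma chart_bump:
  assumes c: "(U, x) \<in> A" "p \<in> U"
  obtains b :: "'e \<Rightarrow> real" and K where "smooth_on UNIV b" "b (x p) = 1" "closed K" "K \<subseteq> U"
    "\<And>q. q \<in> U - K \<Longrightarrow> b (x q) = 0"
proof -
  from c chart_image_open obtain r where r: "r > 0" "cball (x p) r \<subseteq> x ` U"
    by (meson imageI open_contains_cball)
  obtain b :: "'e \<Rightarrow> real" where b: "smooth_on UNIV b" "b (x p) = 1" "\<And>z. r \<le> dist (x p) z \<Longrightarrow> b z = 0"
    using smooth_bump_exists[OF r(1)] by blast
  let ?K = "inv_into U x ` cball (x p) r"
  have "continuous_on (x ` U) (inv_into U x)" "inv_into U x ` x ` U = U"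
    using chart_homeomorphism[OF c(1)] by (auto simp: homeomorphism_def)
  then have "compact ?K" "?K \<subseteq> U"
    using compact_continuous_image[OF continuous_on_subset[OF _ r(2)] compact_cball] image_mono[OF r(2)]
    by metis+
  moreover have "b (x q) = 0" if "q \<in> U - ?K" for q
  proof (rule b(3), rule ccontr)
    assume "\<not> r \<le> dist (x p) (x q)"
    then have "inv_into U x (x q) \<in> ?K" by simp
    with that chart_inverse[OF c(1)] show False by simp
  qed
  ultimately show thesis using b that compact_imp_closed by blast
qed

text \<open>Take the field with constant coordinates \<open>w\<close> in a chart, multiply it by a
  bump function and extend it by zero.\<close>

lemma vector_field_extension:
  assumes "v \<in> tangent_space A p"
  obtains X where "vector_field A X" "X p = v"
proof -
  obtain U x where c: "(U, x) \<in> A" "p \<in> U" by (rule chart_exists)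
  then obtain w where v: "v = chart_vector A U x p w"
    using assms tangent_space_eq_range by blast
  obtain b :: "'e \<Rightarrow> real" and K where b: "smooth_on UNIV b" "b (x p) = 1" and K: "closed K" "K \<subseteq> U"
    and 0: "\<And>q. q \<in> U - K \<Longrightarrow> b (x q) = 0"
    using chart_bump[OF c] by metis
  define X where "X q = (if q \<in> U then b (x q) *\<^sub>R chart_vector A U x q w else 0)" for q
  have "X q \<in> tangent_space A q" for q
  proof (cases "q \<in> U")
    case True
    then have "chart_vector A U x q w \<in> tangent_space A q"
      using tangent_space_eq_range[OF c(1)] by blast
    with True show ?thesis
      using subspace_tangent_space by (simp add: X_def subspace_scale)
  qed (simp add: X_def subspace_0[OF subspace_tangent_space])
  moreover have "smooth_fun A (deriv_along X f)" if f: "smooth_fun A f" for f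
  proof (rule smooth_fun_extend[OF c(1) K])
    let ?f = "f \<circ> inv_into U x"
    note o = chart_image_open[OF c(1)]
    \<comment> \<open>In the chart, \<open>X f\<close> is the bump times the derivative of
      \<open>f\<close> along \<open>w\<close>. One order of differentiability is lost, hence the
      appeal to order \<open>Suc k\<close> for \<open>?f\<close>.\<close>
    have "C_on k (x ` U) (\<lambda>z. b z *\<^sub>R (\<Sum>j\<in>Basis. (w \<bullet> j) *\<^sub>R frechet_derivative ?f (at z) j))" for k
    proof (intro C_on_scaleR C_on_sum C_on_const o)
      show "C_on k (x ` U) b" using b(1) C_on_subset unfolding smooth_on_def by blast
      fix j :: 'e assume "j \<in> Basis"
      moreover have "C_on (Suc k) (x ` U) ?f"
        using smooth_funD[OF f c(1)] unfolding smooth_on_def by blast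
      ultimately show "C_on k (x ` U) (\<lambda>z. frechet_derivative ?f (at z) j)" by simp
    qed
    then have "smooth_on (x ` U) (\<lambda>z. b z *\<^sub>R (\<Sum>j\<in>Basis. (w \<bullet> j) *\<^sub>R frechet_derivative ?f (at z) j))"
      by (simp add: smooth_on_def)
    then show "smooth_on (x ` U) (deriv_along X f \<circ> inv_into U x)"
    proof (rule smooth_on_cong[OF o])
      fix z assume "z \<in> x ` U"
      then obtain q where q: "q \<in> U" "z = x q" by blast
      have "linear (frechet_derivative ?f (at z))"
        using has_derivative_linear[OF smooth_fun_has_derivative[OF f c(1) q(1)]] q by simp
      then have "frechet_derivative ?f (at z) (\<Sum>j\<in>Basis. (w \<bullet> j) *\<^sub>R j)
          = (\<Sum>j\<in>Basis. (w \<bullet> j) *\<^sub>R frechet_derivative ?f (at z) j)"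
        by (simp only: linear_sum linear_scale)
      then show "b z *\<^sub>R (\<Sum>j\<in>Basis. (w \<bullet> j) *\<^sub>R frechet_derivative ?f (at z) j)
          = (deriv_along X f \<circ> inv_into U x) z"
        using q f by (simp add: euclidean_representation deriv_along_def X_def chart_inverse[OF c(1)]
            chart_vector_def scaleR_fun_def)
    qed
    show "deriv_along X f q = 0" if "q \<notin> K" for q
      using 0 that by (simp add: deriv_along_def X_def scaleR_fun_def)
  qed
  ultimately have "vector_field A X" by (simp add: vector_field_def)
  then show thesis by (rule that) (simp add: X_def c b v)
qed

text \<open>Injectivity in \<open>w\<close>, by testing on the cut-off linear function
  \<open>h\<close>. At \<open>x p\<close> the bump is 1 and the linear factor is 0, so the
  derivative along \<open>v\<close> is \<open>v \<bullet> w\<close>; the choice \<open>v = w\<close>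
  gives \<open>w \<bullet> w = 0\<close>.\<close>

lemma chart_vector_eq_0D:
  assumes c: "(U, x) \<in> A" "p \<in> U" and "chart_vector A U x p w = 0"
  shows "w = 0"
proof -
  obtain b :: "'e \<Rightarrow> real" and K where b: "smooth_on UNIV b" "b (x p) = 1" and K: "closed K" "K \<subseteq> U"
    and 0: "\<And>q. q \<in> U - K \<Longrightarrow> b (x q) = 0"
    using chart_bump[OF c] by metis
  define h where "h z = b z * ((z - x p) \<bullet> w)" for z
  define f where "f q = (if q \<in> U then h (x q) else 0)" for q
  note o = chart_image_open[OF c(1)]
  have h: "h z = (f \<circ> inv_into U x) z" if "z \<in> x ` U" for z
    using that by (auto simp: f_def chart_inverse[OF c(1)])
  have "C_on k (x ` U) (\<lambda>z. b z *\<^sub>R ((z + (- x p)) \<bullet> w))" for k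
  proof (intro C_on_scaleR C_on_bounded_linear[OF bounded_linear_inner_left] C_on_add C_on_const C_on_ident o)
    show "C_on k (x ` U) b" using b(1) C_on_subset unfolding smooth_on_def by blast
  qed
  then have "smooth_on (x ` U) h" by (simp add: smooth_on_def h_def[abs_def])
  then have "smooth_on (x ` U) (f \<circ> inv_into U x)" by (rule smooth_on_cong[OF o _ h])
  then have f: "smooth_fun A f"
    by (rule smooth_fun_extend[OF c(1) K]) (use 0 in \<open>auto simp: f_def h_def\<close>)
  obtain b' where b': "(b has_derivative b') (at (x p))"
    using smooth_on_imp_has_derivative[OF open_UNIV b(1)] by blast
  have "(h has_derivative (\<lambda>v. b (x p) * (v \<bullet> w) + b' v * ((x p - x p) \<bullet> w))) (at (x p))"
    unfolding h_def[abs_def] by (intro has_derivative_mult b') (auto intro!: derivative_eq_intros)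
  then have "(h has_derivative (\<lambda>v. v \<bullet> w)) (at (x p))" by (simp add: b)
  then have "(f \<circ> inv_into U x has_derivative (\<lambda>v. v \<bullet> w)) (at (x p))"
    using c by (intro has_derivative_transform_within_open[OF _ o _ h]) auto
  from frechet_derivative_at[OF this, symmetric] f have "chart_vector A U x p w f = w \<bullet> w"
    by (simp add: chart_vector_def)
  with assms(3) show ?thesis by simp
qed

lemma tangent_space_not_line:
  assumes "DIM('e) \<ge> 2"
  obtains v where "v \<in> tangent_space A p" "\<And>c. v \<noteq> c *\<^sub>R u"
proof (rule ccontr)
  assume n: "\<not> thesis"
  obtain U x where c: "(U, x) \<in> A" "p \<in> U" by (rule chart_exists)
  let ?T = "chart_vector A U x p"
  have "\<exists>c. ?T w = c *\<^sub>R u" for w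
    using n that tangent_space_eq_range[OF c] by blast
  then obtain k where k: "\<And>w. ?T w = k w *\<^sub>R u" by metis
  obtain i j :: 'e where ij: "i \<in> Basis" "j \<in> Basis" "i \<noteq> j"
  proof -
    have "\<not> card (Basis :: 'e set) \<le> Suc 0" using assms by simp
    then show thesis using that card_le_Suc0_iff_eq[OF finite_Basis] by blast
  qed
  note lin = linear_chart_vector[OF c]
  \<comment> \<open>If \<open>i\<close> and \<open>j\<close> are sent to \<open>k i\<close> and
    \<open>k j\<close> times \<open>u\<close>, this combination is sent to 0; injectivity then
    forces \<open>k i = 0\<close> and finally \<open>i = 0\<close>.\<close>
  have "?T (k j *\<^sub>R i - k i *\<^sub>R j) = 0"
    unfolding linear_diff[OF lin] linear_scale[OF lin] by (simp add: k mult.commute)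
  then have "k j *\<^sub>R i - k i *\<^sub>R j = 0" by (rule chart_vector_eq_0D[OF c])
  then have "(k j *\<^sub>R i - k i *\<^sub>R j) \<bullet> j = 0" by simp
  then have "k i = 0" using ij by (simp add: inner_diff_left inner_Basis)
  then have "?T i = 0" by (simp add: k)
  with chart_vector_eq_0D[OF c] ij show False by force
qed

section \<open>Vector fields as a module over the smooth functions\<close>

lemma vector_field_tangent: "vector_field A X \<Longrightarrow> X p \<in> tangent_space A p"
  by (simp add: vector_field_def)

lemma vector_field_add:
  assumes "vector_field A X" "vector_field A Y"
  shows "vector_field A (X + Y)"
  using assms smooth_fun_add subspace_tangent_space
  by (auto simp: vector_field_def deriv_along_def subspace_add)

lemma vector_field_fscale:
  assumes "smooth_fun A f" "vector_field A X"
  shows "vector_field A (f \<odot> X)"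
  using assms smooth_fun_mult[OF assms(1)] subspace_scale[OF subspace_tangent_space]
  unfolding vector_field_def deriv_along_def fscale_def by (simp add: scaleR_fun_def)

lemma vector_field_diff:
  assumes "vector_field A X" "vector_field A Y"
  shows "vector_field A (X - Y)"
proof -
  have "X - Y = X + (\<lambda>p. - 1) \<odot> Y" by (auto simp: fscale_def fun_eq_iff)
  then show ?thesis
    using assms vector_field_add vector_field_fscale smooth_fun_const by metis
qed

end


subsection \<open>Metric connections\<close>

locale riemannian_manifold = manifold A
  for A :: "('a::{t2_space, second_countable_topology}, 'e::euclidean_space) chart set" +
  fixes g :: "'a form2"
  assumes riemannian_metric: "riemannian_metric A g"
begin

lemma metric_sym: "u \<in> tangent_space A p \<Longrightarrow> v \<in> tangent_space A p \<Longrightarrow> g p u v = g p v u"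
  using riemannian_metric by (simp add: riemannian_metric_def)

lemma metric_add_right: "u \<in> tangent_space A p \<Longrightarrow> v \<in> tangent_space A p \<Longrightarrow> w \<in> tangent_space A p \<Longrightarrow>
    g p u (v + w) = g p u v + g p u w"
  and metric_scale_right: "u \<in> tangent_space A p \<Longrightarrow> v \<in> tangent_space A p \<Longrightarrow>
    g p u (c *\<^sub>R v) = c * g p u v"
  using riemannian_metric by (simp_all add: riemannian_metric_def linear_on_tangent_def)

lemma metric_diff_right:
  assumes "u \<in> tangent_space A p" "v \<in> tangent_space A p" "w \<in> tangent_space A p"
  shows "g p u (v - w) = g p u v - g p u w"
  using metric_add_right[OF assms(1,2) tangent_scale[OF assms(3), of "- 1"]]
    metric_scale_right[OF assms(1,3), of "- 1"] by simp

lemmas metric_right = metric_add_right metric_scale_right metric_diff_right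

lemma metric_add_left: "u \<in> tangent_space A p \<Longrightarrow> v \<in> tangent_space A p \<Longrightarrow> w \<in> tangent_space A p \<Longrightarrow>
    g p (u + v) w = g p u w + g p v w"
  and metric_scale_left: "u \<in> tangent_space A p \<Longrightarrow> w \<in> tangent_space A p \<Longrightarrow>
    g p (c *\<^sub>R u) w = c * g p u w"
  and metric_diff_left: "u \<in> tangent_space A p \<Longrightarrow> v \<in> tangent_space A p \<Longrightarrow> w \<in> tangent_space A p \<Longrightarrow>
    g p (u - v) w = g p u w - g p v w"
  by (simp_all add: metric_sym[of _ p w] metric_right tangent_add tangent_scale tangent_diff)

lemmas metric_left = metric_add_left metric_scale_left metric_diff_left

lemma metric_eq_0D: "u \<in> tangent_space A p \<Longrightarrow> g p u u = 0 \<Longrightarrow> u = 0"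
  using riemannian_metric unfolding riemannian_metric_def by fastforce

lemma smooth_fun_metric: "vector_field A X \<Longrightarrow> vector_field A Y \<Longrightarrow> smooth_fun A (fapp2 g X Y)"
  using riemannian_metric by (simp add: riemannian_metric_def)

section \<open>Metric compatibility and curvature\<close>

lemma connection_vector_field:
  "metric_connection A g D \<Longrightarrow> vector_field A X \<Longrightarrow> vector_field A Y \<Longrightarrow> vector_field A (D X Y)"
  by (simp add: metric_connection_def linear_connection_def)

lemma metric_connection_deriv:
  "metric_connection A g D \<Longrightarrow> vector_field A X \<Longrightarrow> vector_field A Y \<Longrightarrow> vector_field A Z \<Longrightarrow>
    X p (fapp2 g Y Z) = g p (D X Y p) (Z p) + g p (Y p) (D X Z p)"
  unfolding metric_connection_def deriv_along_def fapp2_def plus_fun_def by meson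

text \<open>The two middle terms together are symmetric in \<open>X\<close> and \<open>Y\<close>, so
  they cancel when the commutator is formed.\<close>

lemma metric_connection_deriv2:
  assumes D: "metric_connection A g D" and vf: "vector_field A X" "vector_field A Y" "vector_field A Z" "vector_field A W"
  shows "X p (deriv_along Y (fapp2 g Z W)) =
    g p (D X (D Y Z) p) (W p) + g p (D Y Z p) (D X W p) + g p (D X Z p) (D Y W p) + g p (Z p) (D X (D Y W) p)"
proof -
  note vfD = connection_vector_field[OF D]
  have "deriv_along Y (fapp2 g Z W) = (\<lambda>q. fapp2 g (D Y Z) W q + fapp2 g Z (D Y W) q)"
    using metric_connection_deriv[OF D vf(2,3,4)] by (auto simp: deriv_along_def fapp2_def)
  then have "X p (deriv_along Y (fapp2 g Z W)) = X p (fapp2 g (D Y Z) W) + X p (fapp2 g Z (D Y W))"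
    using tangent_vector_add[OF vector_field_tangent[OF vf(1)]] vf vfD smooth_fun_metric by simp
  then show ?thesis
    using vf vfD by (simp add: metric_connection_deriv[OF D])
qed

lemma curvature_vector_field:
  assumes "metric_connection A g D" "vector_field A X" "vector_field A Y" "vector_field A Z"
    "vector_field A (lie_bracket X Y)"
  shows "vector_field A (curvature D X Y Z)"
  unfolding curvature_def
  using assms connection_vector_field by (intro vector_field_diff) blast+

text \<open>Apply the commutator of \<open>X\<close> and \<open>Y\<close> to the function
  \<open>g(Z, W)\<close> and expand all three derivatives by metric compatibility. Differentiating
  along the bracket requires it to be a vector field.\<close>

lemma curvature_skew:
  assumes D: "metric_connection A g D" and vf: "vector_field A X" "vector_field A Y" "vector_field A Z" "vector_field A W"
    and b: "vector_field A (lie_bracket X Y)"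
  shows "g p (curvature D X Y Z p) (W p) = - g p (Z p) (curvature D X Y W p)"
proof -
  note vfD = connection_vector_field[OF D]
  have t: "V p \<in> tangent_space A p" if "vector_field A V" for V
    using that by (rule vector_field_tangent)
  have d: "U p - V p \<in> tangent_space A p" if "vector_field A U" "vector_field A V" for U V
    using that t by (simp add: tangent_diff)
  have "lie_bracket X Y p (fapp2 g Z W) =
    X p (deriv_along Y (fapp2 g Z W)) - Y p (deriv_along X (fapp2 g Z W))"
    by (simp add: lie_bracket_def)
  then show ?thesis
    unfolding metric_connection_deriv2[OF D vf] metric_connection_deriv2[OF D vf(2,1,3,4)]
      metric_connection_deriv[OF D b vf(3,4)] curvature_def
    using vf b by (simp add: metric_left metric_right t d vfD)
qed

lemma ricci_eq_0:
  assumes "\<And>X. vector_field A X \<Longrightarrow> curvature D X Y Z p = 0"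
  shows "ricci A D Y Z p = 0"
proof -
  define B where "B = (SOME B. independent B \<and> span B = tangent_space A p)"
  have "\<exists>B. independent B \<and> span B = tangent_space A p"
    using basis_exists[of "tangent_space A p"] span_subspace[OF _ _ subspace_tangent_space] by metis
  then have B: "independent B \<and> span B = tangent_space A p"
    unfolding B_def by (rule someI_ex)
  \<comment> \<open>The choice inside \<open>ricci\<close> is a genuine vector field through
    \<open>v\<close> only because an extension of \<open>v\<close> exists.\<close>
  have "curvature D (SOME X. vector_field A X \<and> X p = v) Y Z p = 0" if "v \<in> B" for v
  proof -
    have "v \<in> tangent_space A p" using B that span_base by blast
    then have "\<exists>X. vector_field A X \<and> X p = v" by (metis vector_field_extension)
    from someI_ex[OF this] show ?thesis using assms by blast
  qed
  then show ?thesis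
    unfolding ricci_def tangent_trace_def B_def[symmetric] Let_def by (simp add: representation_zero)
qed

end

lemma fscale_apply: "(f \<odot> X) p = f p *\<^sub>R X p"
  by (simp add: fscale_def)


subsection \<open>Generalized symmetric metric connections on Kenmotsu manifolds\<close>

locale kenmotsu_gsm =
  fixes A :: "('a::{t2_space, second_countable_topology}, 'e::euclidean_space) chart set"
    and \<phi> :: "'a endo" and \<xi> :: "'a vfield" and \<eta> :: "'a form1" and g :: "'a form2"
    and N D :: "'a conn" and \<alpha> \<beta> :: "'a \<Rightarrow> real"
  assumes kenmotsu: "kenmotsu A \<phi> \<xi> \<eta> g N"
    and connection: "generalized_symmetric_metric_connection A \<phi> \<eta> g \<alpha> \<beta> D"

sublocale kenmotsu_gsm \<subseteq> riemannian_manifold A g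
  using kenmotsu by unfold_locales (auto simp: kenmotsu_def almost_contact_metric_def)

context kenmotsu_gsm
begin

section \<open>Pointwise algebra of the almost contact metric structure\<close>

lemma almost_contact: "almost_contact_metric A \<phi> \<xi> \<eta> g"
  using kenmotsu by (simp add: kenmotsu_def)

lemma xi_vector_field: "vector_field A \<xi>"
  and eta_smooth: "vector_field A X \<Longrightarrow> smooth_fun A (fapp \<eta> X)"
  and phi_xi: "\<phi> p (\<xi> p) = 0"
  and eta_xi: "\<eta> p (\<xi> p) = 1"
  using almost_contact by (simp_all add: almost_contact_metric_def one_form_def)

lemma phi_tangent: "u \<in> tangent_space A p \<Longrightarrow> \<phi> p u \<in> tangent_space A p"
  and eta_phi: "u \<in> tangent_space A p \<Longrightarrow> \<eta> p (\<phi> p u) = 0"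
  and metric_xi: "u \<in> tangent_space A p \<Longrightarrow> g p u (\<xi> p) = \<eta> p u"
  and phi_phi: "u \<in> tangent_space A p \<Longrightarrow> \<phi> p (\<phi> p u) = - u + \<eta> p u *\<^sub>R \<xi> p"
  and metric_phi: "u \<in> tangent_space A p \<Longrightarrow> v \<in> tangent_space A p \<Longrightarrow>
    g p (\<phi> p u) (\<phi> p v) = g p u v - \<eta> p u * \<eta> p v"
  using almost_contact unfolding almost_contact_metric_def endo_field_def by blast+

lemma xi_tangent: "\<xi> p \<in> tangent_space A p"
  by (rule vector_field_tangent[OF xi_vector_field])

lemma metric_xi': "u \<in> tangent_space A p \<Longrightarrow> g p (\<xi> p) u = \<eta> p u"
  using metric_xi metric_sym xi_tangent by metis

lemma eta_add: "u \<in> tangent_space A p \<Longrightarrow> v \<in> tangent_space A p \<Longrightarrow> \<eta> p (u + v) = \<eta> p u + \<eta> p v"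
  and eta_scale: "u \<in> tangent_space A p \<Longrightarrow> \<eta> p (c *\<^sub>R u) = c * \<eta> p u"
  and eta_diff: "u \<in> tangent_space A p \<Longrightarrow> v \<in> tangent_space A p \<Longrightarrow> \<eta> p (u - v) = \<eta> p u - \<eta> p v"
  by (simp_all add: metric_xi[symmetric] metric_left xi_tangent tangent_add tangent_scale tangent_diff)

lemmas eta_linear = eta_add eta_scale eta_diff

text \<open>Write \<open>v\<close> as \<open>\<eta>(v) \<xi> - \<phi>(\<phi> v)\<close> and apply
  the compatibility of \<open>g\<close> with \<open>\<phi>\<close>; the \<open>\<xi>\<close> part
  drops out since \<open>\<eta>(\<phi> u) = 0\<close>.\<close>

lemma metric_phi_skew:
  assumes "u \<in> tangent_space A p" "v \<in> tangent_space A p"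
  shows "g p (\<phi> p u) v = - g p u (\<phi> p v)"
proof -
  have "v = \<eta> p v *\<^sub>R \<xi> p - \<phi> p (\<phi> p v)" by (simp add: phi_phi assms)
  then have "g p (\<phi> p u) v = g p (\<phi> p u) (\<eta> p v *\<^sub>R \<xi> p - \<phi> p (\<phi> p v))" by simp
  also have "\<dots> = - g p u (\<phi> p v)"
    using assms phi_tangent xi_tangent tangent_scale
    by (simp add: metric_right metric_phi metric_xi eta_phi)
  finally show ?thesis .
qed

section \<open>The two connections and the derivative of \<xi>\<close>

lemma levi_civita: "metric_connection A g N"
  and bracket: "vector_field A X \<Longrightarrow> vector_field A Y \<Longrightarrow> lie_bracket X Y = N X Y - N Y X"
  and N_xi: "vector_field A X \<Longrightarrow> N X \<xi> = X - fapp \<eta> X \<odot> \<xi>"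
  using kenmotsu by (simp_all add: kenmotsu_def levi_civita_def torsion_def)

lemma D_metric: "metric_connection A g D"
  and alpha_smooth: "smooth_fun A \<alpha>"
  using connection by (simp_all add: generalized_symmetric_metric_connection_def)

lemma D_torsion:
  assumes "vector_field A X" "vector_field A Y"
  shows "D X Y p - D Y X p - lie_bracket X Y p =
    \<alpha> p *\<^sub>R (\<eta> p (Y p) *\<^sub>R X p - \<eta> p (X p) *\<^sub>R Y p)
    + \<beta> p *\<^sub>R (\<eta> p (Y p) *\<^sub>R \<phi> p (X p) - \<eta> p (X p) *\<^sub>R \<phi> p (Y p))"
proof -
  have "torsion D X Y = \<alpha> \<odot> (fapp \<eta> Y \<odot> X - fapp \<eta> X \<odot> Y) +
      \<beta> \<odot> (fapp \<eta> Y \<odot> fapp \<phi> X - fapp \<eta> X \<odot> fapp \<phi> Y)"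
    using connection assms by (simp add: generalized_symmetric_metric_connection_def)
  from fun_cong[OF this, of p] show ?thesis
    by (simp add: torsion_def fscale_apply fapp_def)
qed

text \<open>Smoothness of the bracket is read off from the torsion-free connection \<open>N\<close>,
  avoiding a computation in charts.\<close>

lemma bracket_vector_field:
  "vector_field A X \<Longrightarrow> vector_field A Y \<Longrightarrow> vector_field A (lie_bracket X Y)"
  using bracket connection_vector_field[OF levi_civita] vector_field_diff by simp

lemmas tangentI = vector_field_tangent connection_vector_field[OF D_metric] connection_vector_field[OF levi_civita]
  xi_vector_field phi_tangent xi_tangent tangent_add
  tangent_scale tangent_diff

lemma D_xi:
  assumes X: "vector_field A X"
  shows "D X \<xi> p = (\<alpha> p + 1) *\<^sub>R (X p - \<eta> p (X p) *\<^sub>R \<xi> p)"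
proof -
  \<comment> \<open>\<open>h\<close> is the difference tensor of the two connections, lowered by
    \<open>g\<close>: skew in its last two arguments because both are metric, and with the torsion
    of \<open>D\<close> as its antisymmetrisation in the first two.\<close>
  define h where "h X Y Z = g p (D X Y p - N X Y p) (Z p)" for X Y Z
  have skew: "h X Y Z = - h X Z Y" if "vector_field A X" "vector_field A Y" "vector_field A Z" for X Y Z
    using metric_connection_deriv[OF D_metric that, of p] metric_connection_deriv[OF levi_civita that, of p] that
      metric_sym[of "Y p" p "N X Z p"] metric_sym[of "Y p" p "D X Z p"]
    by (simp add: h_def metric_left tangentI)
  have tor: "h X Y Z - h Y X Z = g p (\<alpha> p *\<^sub>R (\<eta> p (Y p) *\<^sub>R X p - \<eta> p (X p) *\<^sub>R Y p)
    + \<beta> p *\<^sub>R (\<eta> p (Y p) *\<^sub>R \<phi> p (X p) - \<eta> p (X p) *\<^sub>R \<phi> p (Y p))) (Z p)"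
    if "vector_field A X" "vector_field A Y" "vector_field A Z" for X Y Z
    unfolding D_torsion[OF that(1,2), symmetric] using that
    by (simp add: h_def bracket metric_left tangentI)
  let ?P = "X - fapp \<eta> X \<odot> \<xi>"
  \<comment> \<open>\<open>?Z\<close> is the error of the claimed formula. Pairing with
    \<open>?Z\<close> itself gives \<open>g(?Z, ?Z) = 0\<close>, so definiteness finishes the
    proof.\<close>
  let ?Z = "D X \<xi> - N X \<xi> - \<alpha> \<odot> ?P"
  have P: "vector_field A (\<alpha> \<odot> ?P)"
    by (intro vector_field_fscale vector_field_diff X xi_vector_field eta_smooth alpha_smooth)
  then have Z: "vector_field A ?Z"
    by (intro vector_field_diff connection_vector_field[OF D_metric] connection_vector_field[OF levi_civita] X xi_vector_field)
  note xi = xi_vector_field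
  \<comment> \<open>Koszul's cyclic combination, which expresses \<open>h\<close> by torsion terms
    alone.\<close>
  have "2 * h X \<xi> ?Z = (h X \<xi> ?Z - h \<xi> X ?Z) - (h \<xi> ?Z X - h ?Z \<xi> X) + (h ?Z X \<xi> - h X ?Z \<xi>)"
    using skew[OF X xi Z] skew[OF xi X Z] skew[OF Z X xi] by simp
  also have "\<dots> = 2 * g p ((\<alpha> \<odot> ?P) p) (?Z p)"
    unfolding tor[OF X xi Z] tor[OF xi Z X] tor[OF Z X xi]
  proof -
    define z where "z = ?Z p"
    have z: "z \<in> tangent_space A p" and x: "X p \<in> tangent_space A p"
      unfolding z_def by (rule vector_field_tangent[OF Z], rule vector_field_tangent[OF X])
    \<comment> \<open>Skewness of \<open>\<phi>\<close> is what makes the two surviving \<beta>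
      terms cancel.\<close>
    have s: "g p z (X p) = g p (X p) z" "g p (\<phi> p z) (X p) = - g p (\<phi> p (X p)) z"
      using metric_sym[OF z x] metric_phi_skew[OF z x] metric_sym[OF z phi_tangent[OF x]] by simp_all
    show "g p (\<alpha> p *\<^sub>R (\<eta> p (\<xi> p) *\<^sub>R X p - \<eta> p (X p) *\<^sub>R \<xi> p)
    + \<beta> p *\<^sub>R (\<eta> p (\<xi> p) *\<^sub>R \<phi> p (X p) - \<eta> p (X p) *\<^sub>R \<phi> p (\<xi> p))) (?Z p)
    - g p (\<alpha> p *\<^sub>R (\<eta> p (?Z p) *\<^sub>R \<xi> p - \<eta> p (\<xi> p) *\<^sub>R ?Z p)
    + \<beta> p *\<^sub>R (\<eta> p (?Z p) *\<^sub>R \<phi> p (\<xi> p) - \<eta> p (\<xi> p) *\<^sub>R \<phi> p (?Z p))) (X p)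
    + g p (\<alpha> p *\<^sub>R (\<eta> p (X p) *\<^sub>R ?Z p - \<eta> p (?Z p) *\<^sub>R X p)
    + \<beta> p *\<^sub>R (\<eta> p (X p) *\<^sub>R \<phi> p (?Z p) - \<eta> p (?Z p) *\<^sub>R \<phi> p (X p))) (\<xi> p)
     = 2 * g p ((\<alpha> \<odot> ?P) p) (?Z p)"
      unfolding z_def[symmetric] using x z
      by (simp add: fscale_apply fapp_def eta_xi phi_xi metric_left metric_xi metric_xi' eta_phi eta_linear s tangentI)
        (simp add: algebra_simps)
  qed
  finally have h: "h X \<xi> ?Z = g p ((\<alpha> \<odot> ?P) p) (?Z p)" by simp
  have eq: "?Z p = (D X \<xi> p - N X \<xi> p) - (\<alpha> \<odot> ?P) p" by (simp only: minus_apply)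
  have "D X \<xi> p - N X \<xi> p \<in> tangent_space A p" using X by (simp add: tangentI)
  note metric_diff_left[OF this vector_field_tangent[OF P] vector_field_tangent[OF Z]]
  with arg_cong[OF eq, of "\<lambda>v. g p v (?Z p)"] h have "g p (?Z p) (?Z p) = 0"
    unfolding h_def by linarith
  then have "?Z p = 0" using vector_field_tangent[OF Z] metric_eq_0D by blast
  then show ?thesis
    unfolding N_xi[OF X] by (simp add: fscale_apply fapp_def algebra_simps)
qed

section \<open>Soliton equation and curvature condition\<close>

lemma soliton_ricci:
  assumes "eta_ricci_soliton A \<xi> \<eta> g D l \<mu>" "vector_field A X" "vector_field A Y"
  shows "ricci A D X Y p =
    - (\<alpha> p + 1 + l) * g p (X p) (Y p) + (\<alpha> p + 1 - \<mu>) * (\<eta> p (X p) * \<eta> p (Y p))"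
proof -
  have x: "X p \<in> tangent_space A p" "Y p \<in> tangent_space A p"
    using assms by (simp_all add: vector_field_tangent)
  have "2 * ricci A D X Y p = - g p (D X \<xi> p) (Y p) - g p (X p) (D Y \<xi> p)
      - 2 * l * g p (X p) (Y p) - 2 * \<mu> * \<eta> p (X p) * \<eta> p (Y p)"
    using assms by (simp add: eta_ricci_soliton_def fapp2_def fapp_def)
  also have "\<dots> = 2 * (- (\<alpha> p + 1 + l) * g p (X p) (Y p) + (\<alpha> p + 1 - \<mu>) * (\<eta> p (X p) * \<eta> p (Y p)))"
    unfolding D_xi[OF assms(2)] D_xi[OF assms(3)] using x
    by (simp add: metric_left metric_right metric_xi metric_xi' tangent_scale
        tangent_diff xi_tangent) (simp add: algebra_simps)
  finally show ?thesis by simp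
qed

lemma curvature_D_vector_field: "vector_field A X \<Longrightarrow> vector_field A Y \<Longrightarrow> vector_field A Z \<Longrightarrow>
    vector_field A (curvature D X Y Z)"
  using curvature_vector_field[OF D_metric] bracket_vector_field by blast

text \<open>Skewness against \<xi> reduces every \<eta>-component of the curvature to
  \<open>R(X,Y)\<xi>\<close>.\<close>

lemma eta_curvature:
  assumes "vector_field A X" "vector_field A Y" "vector_field A Z"
  shows "\<eta> p (curvature D X Y Z p) = - g p (Z p) (curvature D X Y \<xi> p)"
  using curvature_skew[OF D_metric assms xi_vector_field bracket_vector_field, of p] assms
  by (simp add: metric_xi vector_field_tangent curvature_D_vector_field)

lemma eta_curvature_xi:
  assumes "vector_field A X" "vector_field A Y"
  shows "\<eta> p (curvature D X Y \<xi> p) = 0"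
  using eta_curvature[OF assms xi_vector_field, of p] curvature_D_vector_field assms xi_vector_field
  by (simp add: metric_xi' vector_field_tangent)

text \<open>Applying the linear form \<eta> turns the vector identity into a scalar one, to be fed
  with curvature fields for \<open>X\<close>.\<close>

lemma eta_ricci_dot_curvature:
  fixes p :: 'a
  assumes dot: "ricci_dot_curvature_zero A \<xi> D"
    and vf: "vector_field A X" "vector_field A Y" "vector_field A Z" "vector_field A W"
  defines "R \<equiv> \<lambda>X Y Z. \<eta> p (curvature D X Y Z p)" and "S \<equiv> \<lambda>X Y. ricci A D X Y p"
  shows "S X (curvature D Y Z W) - S \<xi> (curvature D Y Z W) * \<eta> p (X p)
      + S X Y * R \<xi> Z W - S \<xi> Y * R X Z W + S X Z * R Y \<xi> W - S \<xi> Z * R Y X W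
      + S X W * R Y Z \<xi> - S \<xi> W * R Y Z X = 0"
proof -
  let ?C = "curvature D"
  have "S X (?C Y Z W) *\<^sub>R \<xi> p - S \<xi> (?C Y Z W) *\<^sub>R X p
        + S X Y *\<^sub>R ?C \<xi> Z W p - S \<xi> Y *\<^sub>R ?C X Z W p
        + S X Z *\<^sub>R ?C Y \<xi> W p - S \<xi> Z *\<^sub>R ?C Y X W p
        + S X W *\<^sub>R ?C Y Z \<xi> p - S \<xi> W *\<^sub>R ?C Y Z X p = 0" (is "?v = 0")
    using fun_cong[OF dot[unfolded ricci_dot_curvature_zero_def Let_def, rule_format, OF vf], of p]
    unfolding S_def by (simp only: plus_fun_apply minus_apply zero_fun_apply fscale_apply)
  then have "\<eta> p ?v = 0" using eta_scale[OF xi_tangent, of p 0] by simp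
  then show ?thesis
    unfolding R_def using vf
    by (simp add: eta_linear eta_xi vector_field_tangent curvature_D_vector_field xi_vector_field
        tangent_add
        tangent_scale tangent_diff)
qed

lemma soliton_coefficient_eq_0:
  assumes dim: "DIM('e) \<ge> 2"
    and soliton: "eta_ricci_soliton A \<xi> \<eta> g D l \<mu>"
    and dot: "ricci_dot_curvature_zero A \<xi> D"
  shows "2 * l + \<mu> + \<alpha> p + 1 = 0"
proof (rule ccontr)
  let ?C = "curvature D"
  note xi = xi_vector_field
  note S = soliton_ricci[OF soliton, of _ _ p]
  have t: "V p \<in> tangent_space A p" if "vector_field A V" for V
    using that by (rule vector_field_tangent)
  assume rho: "2 * l + \<mu> + \<alpha> p + 1 \<noteq> 0"
  have R_xi: "?C Y Z \<xi> p = 0" if Y: "vector_field A Y" and Z: "vector_field A Z" for Y Z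
  proof -
    note V = curvature_D_vector_field[OF Y Z xi]
    \<comment> \<open>With \<open>V = R(Y,Z)\<xi>\<close> only \<open>S(V,V)\<close> and
      \<open>- S(\<xi>,\<xi>) \<eta>(R(Y,Z)V)\<close> survive; they equal
      \<open>- (\<alpha> + 1 + l) |V|\<^sup>2\<close> and
      \<open>- (l + \<mu>) |V|\<^sup>2\<close>.\<close>
    have "(2 * l + \<mu> + \<alpha> p + 1) * g p (?C Y Z \<xi> p) (?C Y Z \<xi> p) = 0"
      using eta_ricci_dot_curvature[OF dot V Y Z xi, of p] V Y Z
      by (simp add: S xi curvature_D_vector_field eta_curvature_xi eta_xi metric_xi metric_xi' t xi_tangent
          eta_curvature[of _ _ "?C Y Z \<xi>"] algebra_simps)
    with rho show ?thesis using metric_eq_0D t[OF V] by simp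
  qed
  have "ricci A D \<xi> \<xi> p = 0" using R_xi xi by (intro ricci_eq_0)
  \<comment> \<open>\<open>S(\<xi>,\<xi>) = - (l + \<mu>)\<close>: the \<alpha> terms cancel in the
    direction of \<xi>.\<close>
  then have mu: "\<mu> = - l" using S[OF xi xi] by (simp add: metric_xi xi_tangent eta_xi)
  have R: "?C Y Z W p = 0" if Y: "vector_field A Y" and Z: "vector_field A Z" and W: "vector_field A W" for Y Z W
  proof -
    note V = curvature_D_vector_field[OF Y Z W]
    \<comment> \<open>Now all \<eta>-components of the curvature vanish at \<open>p\<close>, so that
      only \<open>S(V,V)\<close> is left in the scalar identity for
      \<open>V = R(Y,Z)W\<close>.\<close>
    have e: "\<eta> p (?C Y Z W p) = 0" if "vector_field A Y" "vector_field A Z" "vector_field A W" for Y Z W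
      using eta_curvature[OF that, of p] R_xi[OF that(1,2)] metric_scale_right[of "W p" p "W p" 0] t[OF that(3)]
      by simp
    have "(2 * l + \<mu> + \<alpha> p + 1) * g p (?C Y Z W p) (?C Y Z W p) = 0"
      using eta_ricci_dot_curvature[OF dot V Y Z W, of p] V Y Z W
      by (simp add: S xi e mu algebra_simps)
    with rho show ?thesis using metric_eq_0D t[OF V] by simp
  qed
  \<comment> \<open>The dimension bound supplies a direction transverse to \<xi>. There
    \<open>g - \<eta> \<otimes> \<eta>\<close> is nonzero, being the squared length of the component
    \<open>?w\<close> orthogonal to \<xi>.\<close>
  obtain u where u: "u \<in> tangent_space A p" "\<And>c. u \<noteq> c *\<^sub>R \<xi> p"
    using tangent_space_not_line[OF dim] by metis
  obtain X where X: "vector_field A X" "X p = u" using vector_field_extension[OF u(1)] by metis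
  let ?w = "u - \<eta> p u *\<^sub>R \<xi> p"
  have "ricci A D X X p = 0" using R X by (intro ricci_eq_0) blast
  then have "(2 * l + \<mu> + \<alpha> p + 1) * (g p u u - \<eta> p u * \<eta> p u) = 0"
    using S[OF X(1) X(1)] by (simp add: X mu algebra_simps)
  with rho have "g p ?w ?w = 0"
    using u(1) by (simp add: metric_left metric_right metric_xi metric_xi' eta_linear eta_xi xi_tangent
        tangent_scale tangent_diff)
  moreover have "?w \<in> tangent_space A p"
    using u(1) xi_tangent by (simp add: tangent_scale tangent_diff)
  ultimately have "?w = 0" by (intro metric_eq_0D)
  then show False using u(2)[of "\<eta> p u"] by simp
qed

end

theorem theorem8p1:
  fixes A :: "('a::{t2_space, second_countable_topology}, 'e::euclidean_space) chart set"
    and \<phi> :: "'a endo" and \<xi> :: "'a vfield" and \<eta> :: "'a form1" and g :: "'a form2"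
    and N D :: "'a conn" and \<alpha> \<beta> :: "'a \<Rightarrow> real" and l \<mu> :: real
  assumes "DIM('e) \<ge> 3"
    and "kenmotsu A \<phi> \<xi> \<eta> g N"
    and "generalized_symmetric_metric_connection A \<phi> \<eta> g \<alpha> \<beta> D"
    and "eta_ricci_soliton A \<xi> \<eta> g D l \<mu>"
    and "ricci_dot_curvature_zero A \<xi> D"
  shows "\<forall>p. (\<alpha> p + 1) * (2 * l + \<mu> + \<alpha> p + 1) = 0"
proof -
  interpret kenmotsu_gsm A \<phi> \<xi> \<eta> g N D \<alpha> \<beta>
    using assms(2,3) by unfold_locales
  \<comment> \<open>The second factor vanishes at every point.\<close>
  from soliton_coefficient_eq_0[OF _ assms(4,5)] assms(1) show ?thesis by simp
qed

end
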